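(* Let $(V,\omega)$ be a two-dimensional symplectic vector space over the finite field $\mathbb F_q$ of odd characteristic, and let $L_1^\circ,L_2^\circ,L_3^\circ$ be any three oriented Lagrangian subspaces of $V$. Then the canonical intertwining operators satisfy $$\mathsf F_{L_3^\circ,L_2^\circ}\circ \mathsf F_{L_2^\circ,L_1^\circ}=\mathsf F_{L_3^\circ,L_1^\circ}.$$
   Context: Fix a non-trivial additive character $\psi:\mathbb F_q\to\mathbb C^*$ and let $\sigma:\mathbb F_q^*\to\{\pm1\}$ be the Legendre (quadratic) character. An oriented Lagrangian subspace $L^\circ=(L,\varrho_L)$ is a Lagrangian subspace (line) $L\subset V$ together with a function $\varrho_L:L\smallsetminus\{0\}\to\{\pm1\}$ with $\varrho_L(t l)=\sigma(t)\varrho_L(l)$ for $t\in\mathbb F_q^*$ (set $\varrho_L(0)=0$ in sums). The Heisenberg group is $H=V\times\mathbb F_q$ with $(v,\lambda)(v',\lambda')=(v+v',\lambda+\lambda'+\tfrac12\omega(v,v'))$; $v\in V$ is identified with $(v,0)\in H$ and $\lambda\in \mathbb F_q$ with $(0,\lambda)$. For $L^\circ$ let $\mathcal H_{L^\circ}=\{f:H\to\mathbb C\mid f(\lambda l h)=\psi(\lambda)f(h)\ \forall \lambda\in\mathbb F_q,\,l\in L,\,h\in H\}$, on which $H$ acts by right translation. For $L_1\ne L_2$ define $\mathsf F_{L_2^\circ,L_1^\circ}=a_{L_2^\circ,L_1^\circ}\cdot\tilde{\mathsf F}_{L_2^\circ,L_1^\circ}:\mathcal H_{L_1^\circ}\to\mathcal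 H_{L_2^\circ}$, where $$\tilde{\mathsf F}_{L_2^\circ,L_1^\circ}(f)(h)=\sum_{l_2\in L_2}f(l_2h),\qquad a_{L_2^\circ,L_1^\circ}=\frac1q\sum_{l_1\in L_1}\psi(\tfrac12\omega(l_1,\xi_{L_2}))\,\varrho_{L_1}(l_1)\,\varrho_{L_2}(\xi_{L_2}),$$ with $\xi_{L_2}$ any non-zero vector of $L_2$ (the value does not depend on the choice). If $L_1=L_2$, define $\mathsf F_{L_2^\circ,L_1^\circ}=\mathrm I$ if $\varrho_{L_1}=\varrho_{L_2}$ and $\mathsf F_{L_2^\circ,L_1^\circ}=-\mathrm I$ if $\varrho_{L_1}=-\varrho_{L_2}$. *)

theory Defs
  imports Complex_Main "HOL-Library.FuncSet" "HOL-Library.Cardinality"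
begin

locale symplectic_plane = vector_space scale
  for scale :: "'k::field \<Rightarrow> 'v::ab_group_add \<Rightarrow> 'v" +
  fixes omega :: "'v \<Rightarrow> 'v \<Rightarrow> 'k"
  assumes linear_left: "\<And>w. Vector_Spaces.linear scale (*) (\<lambda>v. omega v w)"
    and linear_right: "\<And>v. Vector_Spaces.linear scale (*) (\<lambda>w. omega v w)"
    and alternating: "\<And>v. omega v v = 0"
    and nondegenerate: "\<And>v. (\<And>w. omega v w = 0) \<Longrightarrow> v = 0"
    and dim_2: "dim UNIV = 2"

definition nontrivial_additive_character :: "('k::field \<Rightarrow> complex) \<Rightarrow> bool" where
  "nontrivial_additive_character psi \<longleftrightarrow>
     (\<forall>a. psi a \<noteq> 0) \<and> (\<forall>a b. psi (a + b) = psi a * psi b) \<and> (\<exists>a. psi a \<noteq> 1)"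

definition quadratic_character :: "'k::field \<Rightarrow> int" where
  "quadratic_character t = (if t = 0 then 0 else if \<exists>s. t = s\<^sup>2 then 1 else - 1)"

definition lagrangian :: "('k::field \<Rightarrow> 'v::ab_group_add \<Rightarrow> 'v) \<Rightarrow> ('v \<Rightarrow> 'v \<Rightarrow> 'k) \<Rightarrow> 'v set \<Rightarrow> bool" where
  "lagrangian scale omega L \<longleftrightarrow>
     module.subspace scale L \<and> (\<forall>u\<in>L. \<forall>v\<in>L. omega u v = 0) \<and>
     2 * vector_space.dim scale L = vector_space.dim scale (UNIV :: 'v set)"

text \<open>An orientation is a function on the nonzero vectors of \<open>L\<close> only. It is represented by its
  extension by zero to the whole space, so that equality of oriented subspaces is equality of
  pairs, and sums over \<open>L\<close> may include the zero vector.\<close>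

type_synonym 'v oriented = "'v set \<times> ('v \<Rightarrow> int)"

definition oriented_lagrangian ::
    "('k::field \<Rightarrow> 'v::ab_group_add \<Rightarrow> 'v) \<Rightarrow> ('v \<Rightarrow> 'v \<Rightarrow> 'k) \<Rightarrow> 'v oriented \<Rightarrow> bool" where
  "oriented_lagrangian scale omega = (\<lambda>(L, rho).
     lagrangian scale omega L \<and>
     (\<forall>l. l \<notin> L - {0} \<longrightarrow> rho l = 0) \<and>
     (\<forall>l\<in>L - {0}. rho l \<in> {1, - 1}) \<and>
     (\<forall>t l. t \<noteq> 0 \<longrightarrow> l \<in> L - {0} \<longrightarrow> rho (scale t l) = quadratic_character t * rho l))"

definition heis_mult ::
    "('v \<Rightarrow> 'v \<Rightarrow> 'k) \<Rightarrow> 'v::ab_group_add \<times> 'k::field \<Rightarrow> 'v \<times> 'k \<Rightarrow> 'v \<times> 'k" where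
  "heis_mult omega = (\<lambda>(v, a) (w, b). (v + w, a + b + (1 / 2) * omega v w))"

definition heis_model ::
    "('v \<Rightarrow> 'v \<Rightarrow> 'k) \<Rightarrow> ('k \<Rightarrow> complex) \<Rightarrow> 'v oriented \<Rightarrow> ('v::ab_group_add \<times> 'k::field \<Rightarrow> complex) set"
  where
  "heis_model omega psi Lo =
     {f. \<forall>a. \<forall>l\<in>fst Lo. \<forall>h.
           f (heis_mult omega (heis_mult omega (0, a) (l, 0)) h) = psi a * f h}"

definition averaging ::
    "('v \<Rightarrow> 'v \<Rightarrow> 'k) \<Rightarrow> 'v oriented \<Rightarrow> ('v::ab_group_add \<times> 'k::field \<Rightarrow> complex) \<Rightarrow> 'v \<times> 'k \<Rightarrow> complex"
  where
  "averaging omega L2 f = (\<lambda>h. \<Sum>l\<in>fst L2. f (heis_mult omega (l, 0) h))"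

definition normalization_with ::
    "('v \<Rightarrow> 'v \<Rightarrow> 'k::field) \<Rightarrow> ('k \<Rightarrow> complex) \<Rightarrow> 'v \<Rightarrow> 'v oriented \<Rightarrow> 'v::ab_group_add oriented \<Rightarrow> complex"
  where
  "normalization_with omega psi xi L2 L1 =
     1 / of_nat CARD('k) *
       (\<Sum>l\<in>fst L1. psi ((1 / 2) * omega l xi) * of_int (snd L1 l) * of_int (snd L2 xi))"

text \<open>For distinct lines the value does not depend on the vector chosen here, see
  \<open>normalization_eq\<close> below.\<close>

definition normalization_coeff ::
    "('v \<Rightarrow> 'v \<Rightarrow> 'k::field) \<Rightarrow> ('k \<Rightarrow> complex) \<Rightarrow> 'v oriented \<Rightarrow> 'v::ab_group_add oriented \<Rightarrow> complex"
  where
  "normalization_coeff omega psi L2 L1 =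
     normalization_with omega psi (SOME xi. xi \<in> fst L2 \<and> xi \<noteq> 0) L2 L1"

text \<open>The operator is an extensional function on its domain \<open>heis_model omega psi L1\<close>. Two
  orientations of the same line agree up to a sign (\<open>orientation_dichotomy\<close> below), so the second
  branch is the case of opposite orientations.\<close>

definition intertwiner ::
    "('v \<Rightarrow> 'v \<Rightarrow> 'k) \<Rightarrow> ('k \<Rightarrow> complex) \<Rightarrow> 'v oriented \<Rightarrow> 'v oriented \<Rightarrow>
     ('v::ab_group_add \<times> 'k::field \<Rightarrow> complex) \<Rightarrow> 'v \<times> 'k \<Rightarrow> complex" where
  "intertwiner omega psi L2 L1 = (\<lambda>f\<in>heis_model omega psi L1.
     if fst L1 = fst L2 then (if snd L1 = snd L2 then f else (\<lambda>h. - f h))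
     else (\<lambda>h. normalization_coeff omega psi L2 L1 * averaging omega L2 f h))"

context symplectic_plane
begin

lemma lagrangian_line:
  assumes "lagrangian scale omega L" "xi \<in> L" "xi \<noteq> 0"
  shows "L = range (\<lambda>t. scale t xi)"
proof -
  have d: "dim L = 1" and s: "subspace L"
    using assms(1) dim_2 by (auto simp: lagrangian_def)
  have i: "independent {xi}"
    using assms(3) by simp
  have "L \<subseteq> span {xi}"
  proof (rule ccontr)
    assume "\<not> L \<subseteq> span {xi}"
    then obtain y where y: "y \<in> L" "y \<notin> span {xi}" by blast
    then have i2: "independent {y, xi}" and "y \<noteq> xi"
      using i by (auto simp: independent_insert span_base)
    obtain B where B: "{y, xi} \<subseteq> B" "B \<subseteq> L" "independent B" "L \<subseteq> span B"
      using maximal_independent_subset_extend[of "{y, xi}" L] y(1) assms(2) i2 by auto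
    have c: "card B = 1"
      using basis_card_eq_dim[OF B(2,4,3)] d by simp
    then have "finite B" by (simp add: card_ge_0_finite)
    then have "card {y, xi} \<le> card B" using B(1) by (rule card_mono)
    then show False using c \<open>y \<noteq> xi\<close> by simp
  qed
  moreover have "span {xi} \<subseteq> L"
    using s assms(2) by (simp add: span_minimal)
  ultimately show ?thesis by (simp add: span_singleton)
qed

lemma lagrangian_nonzero:
  assumes "lagrangian scale omega L"
  shows "\<exists>xi. xi \<in> L \<and> xi \<noteq> 0"
proof (rule ccontr)
  assume "\<not> ?thesis"
  then have "L \<subseteq> span {}" by auto
  then have "dim L \<le> card ({} :: 'v set)" by (rule dim_le_card) simp
  then show False using assms dim_2 by (simp add: lagrangian_def)
qed

lemma orientation_dichotomy:
  assumes "oriented_lagrangian scale omega (L, rho1)" "oriented_lagrangian scale omega (L, rho2)"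
  shows "rho1 = rho2 \<or> rho1 = (\<lambda>l. - rho2 l)"
proof -
  have L: "lagrangian scale omega L" using assms(1) by (simp add: oriented_lagrangian_def)
  obtain xi where xi: "xi \<in> L" "xi \<noteq> 0" using lagrangian_nonzero[OF L] by blast
  note line = lagrangian_line[OF L xi]
  have z: "l \<notin> L - {0} \<Longrightarrow> rho l = 0"
    and s: "t \<noteq> 0 \<Longrightarrow> rho (scale t xi) = quadratic_character t * rho xi"
    and v: "rho xi = 1 \<or> rho xi = - 1"
    if "rho \<in> {rho1, rho2}" for rho t l
    using that assms xi by (auto simp: oriented_lagrangian_def)
  have "rho1 l = c * rho2 l" if c: "rho1 xi = c * rho2 xi" for c l
  proof (cases "l \<in> L - {0}")
    case True
    then obtain t where t: "l = scale t xi" "t \<noteq> 0" using line by auto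
    then show ?thesis using c s[of rho1 t] s[of rho2 t] by simp
  next
    case False
    then have "rho1 l = 0" "rho2 l = 0" by (auto intro: z)
    then show ?thesis by simp
  qed
  moreover have "rho1 xi = 1 * rho2 xi \<or> rho1 xi = - 1 * rho2 xi"
    using v[of rho1] v[of rho2] by auto
  ultimately have "(\<forall>l. rho1 l = 1 * rho2 l) \<or> (\<forall>l. rho1 l = - 1 * rho2 l)"
    by blast
  then show ?thesis by (simp add: fun_eq_iff)
qed

lemma normalization_eq:
  assumes "oriented_lagrangian scale omega L1" "oriented_lagrangian scale omega L2"
    and xi: "xi \<in> fst L2" "xi \<noteq> 0"
  shows "normalization_coeff omega psi L2 L1 = normalization_with omega psi xi L2 L1"
proof -
  define zeta where "zeta = (SOME xi. xi \<in> fst L2 \<and> xi \<noteq> 0)"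
  have z: "zeta \<in> fst L2" "zeta \<noteq> 0"
    using someI[of "\<lambda>xi. xi \<in> fst L2 \<and> xi \<noteq> 0" xi] xi by (auto simp: zeta_def)
  have L2: "lagrangian scale omega (fst L2)" and L1: "lagrangian scale omega (fst L1)"
    using assms(1,2) by (auto simp: oriented_lagrangian_def split: prod.splits)
  obtain t where t: "zeta = scale t xi" using lagrangian_line[OF L2 xi] z(1) by auto
  with z(2) have t0: "t \<noteq> 0" by auto
  have r2: "snd L2 zeta = quadratic_character t * snd L2 xi"
    using assms(2) xi t t0 by (auto simp: oriented_lagrangian_def split: prod.splits)
  have r1: "snd L1 (scale t l) = quadratic_character t * snd L1 l" if "l \<in> fst L1" for l
  proof (cases "l = 0")
    case False
    then show ?thesis
      using assms(1) that t0 by (auto simp: oriented_lagrangian_def split: prod.splits)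
  qed (use assms(1) in \<open>auto simp: oriented_lagrangian_def split: prod.splits\<close>)
  have sub: "subspace (fst L1)" using L1 by (simp add: lagrangian_def)
  have om: "omega l (scale t xi) = omega (scale t l) xi" for l
    using linear_left[of xi] linear_right[of l] by (simp add: Vector_Spaces.linear_iff)
  have bij: "bij_betw (scale t) (fst L1) (fst L1)"
    by (rule bij_betw_byWitness[where f' = "scale (inverse t)"])
      (use sub t0 in \<open>auto simp: subspace_scale\<close>)
  have "(\<Sum>l\<in>fst L1. psi ((1/2) * omega l xi) * of_int (snd L1 l) * of_int (snd L2 xi))
      = (\<Sum>l\<in>fst L1. psi ((1/2) * omega (scale t l) xi) * of_int (snd L1 (scale t l))
           * (of_int (snd L2 xi) :: complex))"
    by (rule sum.reindex_bij_betw[OF bij, symmetric])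
  also have "\<dots> = (\<Sum>l\<in>fst L1. psi ((1/2) * omega l zeta) * of_int (snd L1 l)
      * of_int (snd L2 zeta))"
    by (rule sum.cong) (simp_all add: r1 r2[unfolded t] t om mult_ac)
  finally show ?thesis
    unfolding normalization_coeff_def normalization_with_def zeta_def by simp
qed

lemma heis_mult_assoc:
  "heis_mult omega (heis_mult omega x y) z = heis_mult omega x (heis_mult omega y z)"
proof -
  have "omega (u + v) w = omega u w + omega v w" "omega w (u + v) = omega w u + omega w v" for u v w
    using linear_left[of w] linear_right[of w] by (simp_all add: Vector_Spaces.linear_iff)
  then show ?thesis
    by (cases x; cases y; cases z) (simp add: heis_mult_def algebra_simps add_divide_distrib)
qed

lemma averaging_in_model:
  assumes "oriented_lagrangian scale omega L1" "oriented_lagrangian scale omega L2"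
    and f: "f \<in> heis_model omega psi L1"
  shows "averaging omega L2 f \<in> heis_model omega psi L2"
proof -
  have L2: "lagrangian scale omega (fst L2)" and L1: "lagrangian scale omega (fst L1)"
    using assms(1,2) by (auto simp: oriented_lagrangian_def split: prod.splits)
  have sub: "subspace (fst L2)" "subspace (fst L1)" using L1 L2 by (auto simp: lagrangian_def)
  have z: "omega 0 w = 0" "omega w 0 = 0" for w
    using linear_left[of w] linear_right[of w] module_hom.zero[of scale "(*)"]
    by (auto simp: module_hom_iff_linear)
  have c: "f (heis_mult omega (0, a) h) = psi a * f h" for a h
  proof -
    have "heis_mult omega (0, a) (0, 0) = (0, a)" by (simp add: heis_mult_def z)
    moreover have "f (heis_mult omega (heis_mult omega (0, a) (0, 0)) h) = psi a * f h"
      using CollectD[OF f[unfolded heis_model_def], THEN spec, THEN bspec, THEN spec]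
        subspace_0[OF sub(2)] .
    ultimately show ?thesis by simp
  qed
  have m: "heis_mult omega (l', 0) (heis_mult omega (heis_mult omega (0, a) (l, 0)) h)
      = heis_mult omega (0, a) (heis_mult omega (l' + l, 0) h)"
    if "l \<in> fst L2" "l' \<in> fst L2" for l l' a h
  proof -
    have "omega l' l = 0" using that L2 by (auto simp: lagrangian_def)
    then have "heis_mult omega (heis_mult omega (l', 0) (heis_mult omega (0, a) (l, 0))) h
        = heis_mult omega (heis_mult omega (0, a) (l' + l, 0)) h"
      by (simp add: heis_mult_def z)
    then show ?thesis by (simp add: heis_mult_assoc)
  qed
  show ?thesis
    unfolding heis_model_def
  proof (intro CollectI allI ballI)
    fix a l h assume l: "l \<in> fst L2"
    have bij: "bij_betw (\<lambda>l'. l' + l) (fst L2) (fst L2)"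
      by (rule bij_betw_byWitness[where f' = "\<lambda>l'. l' - l"])
        (use sub l in \<open>auto simp: subspace_add subspace_diff\<close>)
    have "averaging omega L2 f (heis_mult omega (heis_mult omega (0, a) (l, 0)) h)
        = (\<Sum>l'\<in>fst L2. psi a * f (heis_mult omega (l' + l, 0) h))"
      unfolding averaging_def by (rule sum.cong) (simp_all add: m l c)
    also have "\<dots> = (\<Sum>l'\<in>fst L2. psi a * f (heis_mult omega (l', 0) h))"
      by (rule sum.reindex_bij_betw[OF bij])
    finally show "averaging omega L2 f (heis_mult omega (heis_mult omega (0, a) (l, 0)) h)
        = psi a * averaging omega L2 f h"
      by (simp add: averaging_def sum_distrib_left)
  qed
qed

lemma intertwiner_funcset:
  assumes "oriented_lagrangian scale omega L1" "oriented_lagrangian scale omega L2"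
  shows "intertwiner omega psi L2 L1 \<in> heis_model omega psi L1 \<rightarrow>\<^sub>E heis_model omega psi L2"
proof (rule PiE_I)
  fix f assume f: "f \<in> heis_model omega psi L1"
  show "intertwiner omega psi L2 L1 f \<in> heis_model omega psi L2"
  proof (cases "fst L1 = fst L2")
    case True
    then show ?thesis
      using f by (simp add: intertwiner_def heis_model_def del: split_paired_All)
  next
    case False
    have "(\<lambda>h. c * g h) \<in> heis_model omega psi L2" if "g \<in> heis_model omega psi L2" for c g
      using that by (simp add: heis_model_def mult.left_commute del: split_paired_All)
    then show ?thesis
      using False f averaging_in_model[OF assms f] by (simp add: intertwiner_def)
  qed
qed (simp add: intertwiner_def)

lemma intertwiner_right_translation:
  assumes "f \<in> heis_model omega psi L1"
  shows "intertwiner omega psi L2 L1 (\<lambda>h. f (heis_mult omega h g))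
       = (\<lambda>h. intertwiner omega psi L2 L1 f (heis_mult omega h g))"
proof -
  have "(\<lambda>h. f (heis_mult omega h g)) \<in> heis_model omega psi L1"
    using assms by (simp add: heis_model_def heis_mult_assoc del: split_paired_All)
  then show ?thesis
    using assms by (simp add: intertwiner_def averaging_def heis_mult_assoc)
qed

end

end

theory Submission
  imports Defs
begin

text \<open>Fix nonzero vectors \<open>e\<^sub>i \<in> L\<^sub>i\<close>, put \<open>\<omega>\<^sub>i\<^sub>j = \<omega>(e\<^sub>i,e\<^sub>j)\<close>, and let \<open>G\<close> be the quadratic Gauss sum of
  \<open>\<psi>\<close>. For \<open>L\<^sub>1 \<noteq> L\<^sub>2\<close> the normalization is \<open>G/q \<cdot> \<sigma>(\<omega>\<^sub>1\<^sub>2/2) \<rho>\<^sub>1(e\<^sub>1) \<rho>\<^sub>2(e\<^sub>2)\<close>. For pairwise distinct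
  lines, expanding \<open>e\<^sub>2\<close> in the basis \<open>e\<^sub>1, e\<^sub>3\<close> shows that averaging over \<open>L\<^sub>2\<close> and then over \<open>L\<^sub>3\<close>
  is averaging over \<open>L\<^sub>3\<close> times \<open>\<Sum>\<^sub>s \<psi>(- s\<^sup>2 \<omega>\<^sub>1\<^sub>2 \<omega>\<^sub>2\<^sub>3 / (2 \<omega>\<^sub>1\<^sub>3))\<close>, which is \<open>G\<close> up to an explicit
  value of \<open>\<sigma>\<close>. All signs then cancel by multiplicativity of \<open>\<sigma>\<close> and \<open>G\<^sup>2 = \<sigma>(-1) q\<close>. If
  \<open>L\<^sub>1 = L\<^sub>3 \<noteq> L\<^sub>2\<close>, the double average is instead \<open>q\<close> times the identity, by orthogonality of
  characters.\<close>

section \<open>Quadratic characters and Gauss sums of finite fields\<close>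

lemma card_square_roots:
  fixes x :: "'k::{field,finite}"
  assumes two: "(2::'k) \<noteq> 0"
  shows "int (card {s. s\<^sup>2 = x}) = 1 + quadratic_character x"
proof -
  consider "x = 0" | a where "x = a\<^sup>2" "a \<noteq> 0" | "x \<noteq> 0" "\<nexists>a. x = a\<^sup>2"
    by (metis zero_power2)
  then show ?thesis
  proof cases
    case 1
    then show ?thesis by (simp add: quadratic_character_def)
  next
    case (2 a)
    have "{s. s\<^sup>2 = x} = {a, - a}"
      using 2 by (auto simp: power2_eq_iff)
    moreover have "a \<noteq> - a"
    proof
      assume "a = - a"
      then have "2 * a = 0" by (simp add: eq_neg_iff_add_eq_0)
      then show False using two 2 by simp
    qed
    ultimately have "card {s. s\<^sup>2 = x} = 2" by simp
    then show ?thesis using 2 by (auto simp: quadratic_character_def)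
  next
    case 3
    then have "{s. s\<^sup>2 = x} = {}" by auto
    then show ?thesis using 3 by (simp add: quadratic_character_def)
  qed
qed

text \<open>Grouping the \<open>s\<close> by their square, the fibre over \<open>x\<close> has 1 +
  \<sigma>(x) elements. The constant function 1 gives the vanishing of the sum of \<sigma>; additive
  characters give the quadratic Gauss sum.\<close>

lemma sum_over_squares:
  fixes g :: "'k::{field,finite} \<Rightarrow> 'a::comm_ring_1"
  assumes two: "(2::'k) \<noteq> 0"
  shows "(\<Sum>s\<in>UNIV. g (s\<^sup>2)) = (\<Sum>x\<in>UNIV. (1 + of_int (quadratic_character x)) * g x)"
proof -
  have "(\<Sum>s\<in>UNIV. g (s\<^sup>2)) = (\<Sum>x\<in>UNIV. \<Sum>s | s \<in> UNIV \<and> s\<^sup>2 = x. g (s\<^sup>2))"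
    by (rule sum.group[symmetric]) auto
  also have "\<dots> = (\<Sum>x\<in>UNIV. of_int (int (card {s. s\<^sup>2 = x})) * g x)"
    by simp
  finally show ?thesis
    by (simp only: card_square_roots[OF two] of_int_add of_int_1)
qed

lemma sum_quadratic_character:
  assumes "(2::'k::{field,finite}) \<noteq> 0"
  shows "(\<Sum>x\<in>(UNIV::'k set). quadratic_character x) = 0"
  using sum_over_squares[OF assms, of "\<lambda>_. 1 :: int"] by (simp add: sum.distrib)

lemma quadratic_character_0 [simp]: "quadratic_character 0 = 0"
  by (simp add: quadratic_character_def)

lemma quadratic_character_square_mult:
  assumes "a \<noteq> 0"
  shows "quadratic_character (a\<^sup>2 * x) = quadratic_character x"
proof -
  have "(\<exists>s. a\<^sup>2 * x = s\<^sup>2) \<longleftrightarrow> (\<exists>s. x = s\<^sup>2)"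
  proof
    assume "\<exists>s. a\<^sup>2 * x = s\<^sup>2"
    then obtain s where "a\<^sup>2 * x = s\<^sup>2" ..
    then have "x = (s / a)\<^sup>2" using assms by (simp add: field_simps)
    then show "\<exists>s. x = s\<^sup>2" ..
  next
    assume "\<exists>s. x = s\<^sup>2"
    then show "\<exists>s. a\<^sup>2 * x = s\<^sup>2" by (metis power_mult_distrib)
  qed
  then show ?thesis using assms by (simp add: quadratic_character_def)
qed

text \<open>That two nonsquares multiply to a square is a counting fact: multiplication by a
  nonsquare permutes the field and sends nonzero squares to nonsquares. Both classes have the same
  size, so it exchanges them.\<close>

lemma quadratic_character_mult:
  fixes x y :: "'k::{field,finite}"
  assumes two: "(2::'k) \<noteq> 0"
  shows "quadratic_character (x * y) = quadratic_character x * quadratic_character y"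
proof -
  consider "x = 0" | a where "x = a\<^sup>2" "a \<noteq> 0" | "x \<noteq> 0" "\<nexists>a. x = a\<^sup>2"
    by (metis zero_power2)
  then show ?thesis
  proof cases
    case 1
    then show ?thesis by simp
  next
    case (2 a)
    moreover have "quadratic_character (a\<^sup>2) = 1"
      using 2 by (auto simp: quadratic_character_def)
    ultimately show ?thesis by (simp add: quadratic_character_square_mult)
  next
    case 3
    then have x: "quadratic_character x = - 1" by (simp add: quadratic_character_def)
    text \<open>The terms of \<open>\<Sum>y. \<sigma>(x y) + \<sigma>(y) = 0\<close> are all nonpositive, hence zero.\<close>
    have le: "quadratic_character (x * y) + quadratic_character y \<le> 0" for y
    proof -
      consider "y = 0" | a where "y = a\<^sup>2" "a \<noteq> 0" | "y \<noteq> 0" "\<nexists>a. y = a\<^sup>2"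
        by (metis zero_power2)
      then show ?thesis
      proof cases
        case (2 a)
        then show ?thesis
          using x quadratic_character_square_mult[of a x]
          by (simp add: mult.commute) (simp add: quadratic_character_def)
      qed (auto simp: quadratic_character_def)
    qed
    have "bij ((*) x)"
      by (rule bij_betw_byWitness[where f' = "\<lambda>y. y / x"]) (use 3 in auto)
    then have "(\<Sum>y\<in>UNIV. quadratic_character (x * y)) = (\<Sum>y\<in>(UNIV::'k set). quadratic_character y)"
      by (rule sum.reindex_bij_betw)
    then have "(\<Sum>y\<in>UNIV. - (quadratic_character (x * y) + quadratic_character y)) = 0"
      by (simp only: sum_negf sum.distrib sum_quadratic_character[OF two])
    moreover have "0 \<le> - (quadratic_character (x * y) + quadratic_character y)" for y
      using le by (simp only: neg_0_le_iff_le)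
    ultimately have "\<forall>y\<in>UNIV. - (quadratic_character (x * y) + quadratic_character y) = 0"
      by (subst (asm) sum_nonneg_eq_0_iff) simp_all
    then have "- (quadratic_character (x * y) + quadratic_character y) = 0" by blast
    then show ?thesis using x by simp
  qed
qed

lemma quadratic_character_self_mult:
  assumes "x \<noteq> 0"
  shows "quadratic_character x * quadratic_character x = 1"
  using assms by (simp add: quadratic_character_def)

section \<open>Gauss sums of a nontrivial additive character\<close>

definition gauss_sum :: "('k::{field,finite} \<Rightarrow> complex) \<Rightarrow> complex" where
  "gauss_sum psi = (\<Sum>t\<in>UNIV. psi t * of_int (quadratic_character t))"

context
  fixes psi :: "'k::{field,finite} \<Rightarrow> complex"
  assumes psi: "nontrivial_additive_character psi"
begin

lemma additive_character_add: "psi (a + b) = psi a * psi b"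
  using psi by (simp add: nontrivial_additive_character_def)

lemma additive_character_0: "psi 0 = 1"
  using psi additive_character_add[of 0 0] by (simp add: nontrivial_additive_character_def)

text \<open>Translation by some \<open>a\<close> with \<open>psi a \<noteq> 1\<close> preserves the
  full sum but also multiplies it by \<open>psi a\<close>.\<close>

lemma sum_additive_character:
  "(\<Sum>t\<in>UNIV. psi (c * t)) = (if c = 0 then of_nat CARD('k) else 0)"
proof (cases "c = 0")
  case False
  obtain a where a: "psi a \<noteq> 1"
    using psi by (auto simp: nontrivial_additive_character_def)
  have "bij ((*) c)"
    by (rule bij_betw_byWitness[where f' = "\<lambda>y. y / c"]) (use False in auto)
  then have eq: "(\<Sum>t\<in>UNIV. psi (c * t)) = (\<Sum>t\<in>UNIV. psi t)"
    by (rule sum.reindex_bij_betw)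
  have "bij ((+) a)"
    by (rule bij_betw_byWitness[where f' = "\<lambda>y. y - a"]) auto
  then have "(\<Sum>t\<in>UNIV. psi (a + t)) = (\<Sum>t\<in>UNIV. psi t)"
    by (rule sum.reindex_bij_betw)
  then have "psi a * (\<Sum>t\<in>UNIV. psi t) = (\<Sum>t\<in>UNIV. psi t)"
    by (simp add: additive_character_add sum_distrib_left)
  then show ?thesis using a eq False by simp
qed (simp add: additive_character_0)

context
  assumes two: "(2::'k) \<noteq> 0"
begin

text \<open>For nonzero \<open>c\<close>, substitute \<open>c * t\<close> for \<open>t\<close> and
  use \<sigma>(c) = \<sigma>(c)^{-1}. For \<open>c = 0\<close> both sides vanish, since \<sigma>
  sums to 0.\<close>

lemma gauss_sum_twist:
  "(\<Sum>t\<in>UNIV. psi (c * t) * of_int (quadratic_character t))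
     = of_int (quadratic_character c) * gauss_sum psi"
proof (cases "c = 0")
  case True
  then show ?thesis
    using sum_quadratic_character[OF two]
    by (simp add: additive_character_0 flip: of_int_sum)
next
  case False
  have "bij ((*) c)"
    by (rule bij_betw_byWitness[where f' = "\<lambda>y. y / c"]) (use False in auto)
  then have "gauss_sum psi = (\<Sum>t\<in>UNIV. psi (c * t) * of_int (quadratic_character (c * t)))"
    unfolding gauss_sum_def by (rule sum.reindex_bij_betw[symmetric])
  also have "\<dots> = of_int (quadratic_character c)
      * (\<Sum>t\<in>UNIV. psi (c * t) * of_int (quadratic_character t))"
    by (simp add: quadratic_character_mult[OF two] sum_distrib_left mult_ac)
  finally have "of_int (quadratic_character c) * gauss_sum psi
      = of_int (quadratic_character c * quadratic_character c)
        * (\<Sum>t\<in>UNIV. psi (c * t) * of_int (quadratic_character t))"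
    by (simp add: mult.assoc)
  then show ?thesis by (simp add: quadratic_character_self_mult[OF False])
qed

text \<open>Of the weight 1 + \<sigma>(x), the part 1 contributes 0 by orthogonality, as
  \<open>c\<close> is nonzero; the part \<sigma>(x) is a twisted Gauss sum.\<close>

lemma quadratic_gauss_sum:
  assumes "c \<noteq> 0"
  shows "(\<Sum>s\<in>UNIV. psi (c * s\<^sup>2)) = of_int (quadratic_character c) * gauss_sum psi"
proof -
  have "(\<Sum>s\<in>UNIV. psi (c * s\<^sup>2))
      = (\<Sum>x\<in>UNIV. (1 + of_int (quadratic_character x)) * psi (c * x))"
    by (rule sum_over_squares[OF two, of "\<lambda>x. psi (c * x)"])
  also have "\<dots> = (\<Sum>x\<in>UNIV. psi (c * x))
      + (\<Sum>x\<in>UNIV. psi (c * x) * of_int (quadratic_character x))"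
    by (simp add: algebra_simps sum.distrib)
  finally show ?thesis by (simp add: sum_additive_character gauss_sum_twist assms)
qed

text \<open>After writing the square as a double sum, orthogonality in \<open>x\<close> kills every
  term except \<open>t = - 1\<close>.\<close>

lemma gauss_sum_square:
  "gauss_sum psi * gauss_sum psi = of_int (quadratic_character (-1 :: 'k)) * of_nat CARD('k)"
proof -
  have "gauss_sum psi * gauss_sum psi
      = (\<Sum>x\<in>UNIV. psi x * (of_int (quadratic_character x) * gauss_sum psi))"
    by (simp add: gauss_sum_def sum_distrib_right mult_ac)
  \<comment> \<open>Read backwards, \<open>gauss_sum_twist\<close> absorbs \<sigma>(x) into the
    phase \<open>psi (x * t)\<close>, for \<open>x = 0\<close> as well.\<close>
  also have "\<dots> = (\<Sum>x\<in>UNIV. \<Sum>t\<in>UNIV. psi ((1 + t) * x) * of_int (quadratic_character t))"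
  proof -
    have "psi ((1 + t) * x) = psi x * psi (x * t)" for x t
      by (simp add: distrib_right additive_character_add mult.commute[of x t])
    then show ?thesis
      unfolding gauss_sum_twist[symmetric] by (simp add: sum_distrib_left mult.assoc)
  qed
  also have "\<dots> = (\<Sum>t\<in>UNIV. \<Sum>x\<in>UNIV. psi ((1 + t) * x) * of_int (quadratic_character t))"
    by (rule sum.swap)
  also have "\<dots> = (\<Sum>t\<in>(UNIV::'k set). if t = - 1
      then of_nat CARD('k) * of_int (quadratic_character t) else 0)"
    by (rule sum.cong)
      (auto simp: sum_additive_character eq_neg_iff_add_eq_0 add.commute
        simp flip: sum_distrib_right)
  finally show ?thesis by (simp add: mult.commute)
qed

end

end

section \<open>Intertwining operators in coordinates\<close>

locale heisenberg_plane = symplectic_plane scale omega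
  for scale :: "'k::{field,finite} \<Rightarrow> 'v::ab_group_add \<Rightarrow> 'v"
    and omega :: "'v \<Rightarrow> 'v \<Rightarrow> 'k" +
  fixes psi :: "'k \<Rightarrow> complex"
  assumes psi: "nontrivial_additive_character psi"
    and two: "(2::'k) \<noteq> 0"
begin

section \<open>Linear algebra of the symplectic plane\<close>

lemma omega_simps [simp]:
  "omega (u + v) w = omega u w + omega v w" "omega w (u + v) = omega w u + omega w v"
  "omega (scale t u) w = t * omega u w" "omega w (scale t u) = t * omega w u"
  "omega 0 w = 0" "omega w 0 = 0" "omega v v = 0"
proof -
  show "omega (u + v) w = omega u w + omega v w" "omega w (u + v) = omega w u + omega w v"
    and sc: "omega (scale t u) w = t * omega u w" "omega w (scale t u) = t * omega w u" for t u
    using linear_left[of w] linear_right[of w] by (simp_all add: Vector_Spaces.linear_iff)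
  show "omega 0 w = 0" "omega w 0 = 0" "omega v v = 0"
    using sc[of 0 0] alternating by simp_all
qed

lemma omega_swap: "omega v w = - omega w v"
  using alternating[of "v + w"] by (simp add: eq_neg_iff_add_eq_0 del: omega_simps(7))
    (simp add: add.commute)

lemma span_two_vectors:
  assumes "u \<noteq> 0" "v \<notin> span {u}"
  shows "span {u, v} = UNIV"
proof -
  have i: "independent {v, u}"
    using assms by (simp add: independent_insert)
  have "v \<noteq> u" using assms(2) by (auto simp: span_base)
  obtain B where B: "{v, u} \<subseteq> B" "independent B" "UNIV \<subseteq> span B"
    using maximal_independent_subset_extend[of "{v, u}" UNIV] i by auto
  have c: "card B = 2" using basis_card_eq_dim[of B UNIV] B dim_2 by simp
  then have "finite B" by (simp add: card_ge_0_finite)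
  moreover have "card {v, u} = 2" using \<open>v \<noteq> u\<close> by simp
  ultimately have "{v, u} = B" using B(1) c by (metis card_subset_eq)
  then show ?thesis using B(3) by (auto simp: insert_commute)
qed

text \<open>Otherwise \<open>u\<close> and \<open>v\<close> would span the plane and
  \<open>u\<close> would be orthogonal to everything, against nondegeneracy.\<close>

lemma omega_eq_0_imp_span:
  assumes "u \<noteq> 0" "omega u v = 0"
  shows "v \<in> span {u}"
proof (rule ccontr)
  assume v: "v \<notin> span {u}"
  have "omega u w = 0" for w
  proof -
    have "w \<in> span {u, v}" using span_two_vectors[OF assms(1) v] by simp
    then obtain a b where "w = scale a u + scale b v"
      by (auto simp: span_insert span_singleton algebra_simps)
    then show ?thesis using assms(2) by simp
  qed
  then show False using assms(1) nondegenerate by blast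
qed

text \<open>Cramer's rule: pairing with \<open>w\<close> isolates the coefficient of
  \<open>u\<close>, and pairing with \<open>u\<close> that of \<open>w\<close>.\<close>

lemma decompose:
  assumes "omega u w \<noteq> 0"
  shows "v = scale (omega v w / omega u w) u + scale (omega u v / omega u w) w"
proof -
  have u: "u \<noteq> 0" using assms by auto
  have w: "w \<notin> span {u}" using assms by (auto simp: span_singleton)
  have "v \<in> span {u, w}" using span_two_vectors[OF u w] by simp
  then obtain a b where "v = scale a u + scale b w"
    by (auto simp: span_insert span_singleton algebra_simps)
  then show ?thesis using assms by simp
qed

text \<open>The scaling law here covers \<open>t = 0\<close> and \<open>e = 0\<close>, because both
  the orientation and \<sigma> are extended by zero. It can thus be used under sums over the whole
  field.\<close>

lemma oriented_lagrangianD: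
  assumes "oriented_lagrangian scale omega L"
  shows "lagrangian scale omega (fst L)"
    and "snd L 0 = 0"
    and "e \<in> fst L \<Longrightarrow> snd L (scale t e) = quadratic_character t * snd L e"
    and "e \<in> fst L \<Longrightarrow> e \<noteq> 0 \<Longrightarrow> snd L e * snd L e = 1"
proof -
  show "lagrangian scale omega (fst L)" and 0: "snd L 0 = 0"
    using assms by (auto simp: oriented_lagrangian_def split: prod.splits)
  show "snd L e * snd L e = 1" if "e \<in> fst L" "e \<noteq> 0"
  proof -
    have "snd L e = 1 \<or> snd L e = - 1"
      using assms that by (auto simp: oriented_lagrangian_def split: prod.splits)
    then show ?thesis by auto
  qed
  show "e \<in> fst L \<Longrightarrow> snd L (scale t e) = quadratic_character t * snd L e"
    using assms 0 by (cases "t = 0"; cases "e = 0")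
      (auto simp: oriented_lagrangian_def split: prod.splits)
qed

lemma distinct_lines_omega:
  assumes L: "lagrangian scale omega A" "lagrangian scale omega B" "A \<noteq> B"
    and u: "u \<in> A" "u \<noteq> 0" and v: "v \<in> B" "v \<noteq> 0"
  shows "omega u v \<noteq> 0"
proof
  assume "omega u v = 0"
  then have "v \<in> A"
    using omega_eq_0_imp_span[OF u(2)] lagrangian_line[OF L(1) u] by (simp add: span_singleton)
  then show False
    using lagrangian_line[OF L(1) _ v(2)] lagrangian_line[OF L(2) v] L(3) by simp
qed

section \<open>Sums over a line and the normalization as a Gauss sum\<close>

lemma sum_line:
  assumes "lagrangian scale omega A" "e \<in> A" "e \<noteq> 0"
  shows "(\<Sum>l\<in>A. g l) = (\<Sum>t\<in>UNIV. g (scale t e))"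
proof -
  have "inj (\<lambda>t. scale t e)" using assms(3) by (auto intro!: injI)
  then show ?thesis
    unfolding lagrangian_line[OF assms] by (simp add: sum.reindex)
qed

text \<open>Parametrizing the first line by \<open>scale t e1\<close> turns its orientation into
  \<sigma>(t) times a sign, so the sum is a Gauss sum twisted by
  \<open>omega e1 e2 / 2\<close>.\<close>

lemma normalization_value:
  assumes "oriented_lagrangian scale omega L1" "oriented_lagrangian scale omega L2"
    and e1: "e1 \<in> fst L1" "e1 \<noteq> 0" and e2: "e2 \<in> fst L2" "e2 \<noteq> 0"
  shows "normalization_coeff omega psi L2 L1
    = gauss_sum psi / of_nat CARD('k)
      * of_int (quadratic_character (omega e1 e2 / 2) * snd L1 e1 * snd L2 e2)"
proof -
  note o1 = oriented_lagrangianD[OF assms(1)]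
  have "normalization_coeff omega psi L2 L1 = 1 / of_nat CARD('k)
      * (\<Sum>t\<in>UNIV. psi (omega e1 e2 / 2 * t) * of_int (quadratic_character t)
          * of_int (snd L1 e1 * snd L2 e2))"
    unfolding normalization_eq[OF assms(1,2) e2] normalization_with_def sum_line[OF o1(1) e1]
    by (simp add: o1(3)[OF e1(1)] mult_ac)
  also have "\<dots> = 1 / of_nat CARD('k)
      * (of_int (quadratic_character (omega e1 e2 / 2)) * gauss_sum psi
          * of_int (snd L1 e1 * snd L2 e2))"
    by (simp only: gauss_sum_twist[OF psi two] flip: sum_distrib_right)
  finally show ?thesis by simp
qed

section \<open>Equivariance and double averages\<close>

lemma heis_model_central:
  assumes "f \<in> heis_model omega psi L" "oriented_lagrangian scale omega L"
  shows "f (heis_mult omega (0, a) h) = psi a * f h"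
proof -
  have "0 \<in> fst L"
    using oriented_lagrangianD(1)[OF assms(2)] by (auto simp: lagrangian_def subspace_0)
  then have "f (heis_mult omega (heis_mult omega (0, a) (0, 0)) h) = psi a * f h"
    using assms(1) unfolding heis_model_def by blast
  then show ?thesis by (simp add: heis_mult_def)
qed

lemma heis_model_line:
  assumes "f \<in> heis_model omega psi L" "l \<in> fst L"
  shows "f (heis_mult omega (l, 0) h) = f h"
proof -
  have "f (heis_mult omega (heis_mult omega (0, 0) (l, 0)) h) = psi 0 * f h"
    using assms unfolding heis_model_def by blast
  then show ?thesis by (simp add: heis_mult_def additive_character_0[OF psi])
qed

text \<open>Each product of an element of \<open>L2\<close> and one of \<open>L3\<close> factors as
  a central element, an element of \<open>L1\<close> and one of \<open>L3\<close>. The function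
  \<open>f\<close> turns the first into a phase and ignores the second.\<close>

lemma averaging_averaging_distinct:
  assumes "oriented_lagrangian scale omega L1" "oriented_lagrangian scale omega L2"
      "oriented_lagrangian scale omega L3"
    and e1: "e1 \<in> fst L1" "e1 \<noteq> 0" and e2: "e2 \<in> fst L2" "e2 \<noteq> 0"
    and e3: "e3 \<in> fst L3" "e3 \<noteq> 0"
    and f: "f \<in> heis_model omega psi L1"
    and w13: "omega e1 e3 \<noteq> 0"
  shows "averaging omega L3 (averaging omega L2 f) h
    = (\<Sum>s\<in>UNIV. psi (- (omega e1 e2 * omega e2 e3 / omega e1 e3) / 2 * s\<^sup>2)) * averaging omega L3 f h"
proof -
  note lag = oriented_lagrangianD(1)[OF assms(1)] oriented_lagrangianD(1)[OF assms(2)]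
    oriented_lagrangianD(1)[OF assms(3)]
  have sub: "subspace (fst L1)" using lag(1) by (simp add: lagrangian_def)
  define a where "a = omega e2 e3 / omega e1 e3"
  define b where "b = omega e1 e2 / omega e1 e3"
  define c where "c = - (omega e1 e2 * omega e2 e3 / omega e1 e3) / 2"
  have e2_eq: "e2 = scale a e1 + scale b e3"
    unfolding a_def b_def by (rule decompose[OF w13])
  have w23: "omega e2 e3 = a * omega e1 e3" using w13 by (simp add: a_def)
  have c_eq: "c = - (a * b * omega e1 e3) / 2" using w13 by (simp add: a_def b_def c_def)
  \<comment> \<open>The cocycle terms in \<open>s * t\<close> cancel because
    \<open>omega e2 e3 = a * omega e1 e3\<close>. The remaining phase does not depend on
    \<open>t\<close>, so the shift by \<open>s * b\<close> can be removed from the sum over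
    \<open>t\<close>.\<close>
  have split: "heis_mult omega (scale s e2, 0) (scale t e3, 0)
    = heis_mult omega (0, c * s\<^sup>2)
        (heis_mult omega (scale (s * a) e1, 0) (scale (s * b + t) e3, 0))" for s t
    unfolding heis_mult_def c_eq
    by (simp add: w23 e2_eq scale_right_distrib scale_left_distrib algebra_simps power2_eq_square)
  have "f (heis_mult omega (scale s e2, 0) (heis_mult omega (scale t e3, 0) h))
    = psi (c * s\<^sup>2) * f (heis_mult omega (scale (s * b + t) e3, 0) h)" for s t
  proof -
    have "scale (s * a) e1 \<in> fst L1" using sub e1(1) by (rule subspace_scale)
    then show ?thesis
      unfolding heis_mult_assoc[symmetric] split
      by (simp add: heis_mult_assoc heis_model_central[OF f assms(1)] heis_model_line[OF f])
  qed
  then have "averaging omega L3 (averaging omega L2 f) h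
    = (\<Sum>t\<in>UNIV. \<Sum>s\<in>UNIV. psi (c * s\<^sup>2) * f (heis_mult omega (scale (s * b + t) e3, 0) h))"
    unfolding averaging_def sum_line[OF lag(2) e2] sum_line[OF lag(3) e3] by simp
  also have "\<dots> = (\<Sum>s\<in>UNIV. \<Sum>t\<in>UNIV. psi (c * s\<^sup>2)
      * f (heis_mult omega (scale (s * b + t) e3, 0) h))"
    by (rule sum.swap)
  also have "\<dots> = (\<Sum>s\<in>UNIV. psi (c * s\<^sup>2) * averaging omega L3 f h)"
  proof (rule sum.cong)
    fix s
    have "bij ((+) (s * b))"
      by (rule bij_betw_byWitness[where f' = "\<lambda>y. y - s * b"]) auto
    then have "(\<Sum>t\<in>UNIV. f (heis_mult omega (scale (s * b + t) e3, 0) h))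
        = (\<Sum>t\<in>UNIV. f (heis_mult omega (scale t e3, 0) h))"
      by (rule sum.reindex_bij_betw)
    then show "(\<Sum>t\<in>UNIV. psi (c * s\<^sup>2) * f (heis_mult omega (scale (s * b + t) e3, 0) h))
        = psi (c * s\<^sup>2) * averaging omega L3 f h"
      unfolding averaging_def sum_line[OF lag(3) e3] by (simp flip: sum_distrib_left)
  qed simp
  finally show ?thesis by (simp add: c_def sum_distrib_right)
qed

text \<open>Here the two factors are commuted instead of decomposed. The commutator is central,
  \<open>f\<close> ignores the factor in \<open>L1\<close>, and summing the commutator phase over
  \<open>t\<close> leaves only \<open>s = 0\<close>.\<close>

lemma averaging_averaging_back:
  assumes "oriented_lagrangian scale omega L1" "oriented_lagrangian scale omega L2"
      "oriented_lagrangian scale omega L3"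
    and eq: "fst L1 = fst L3" and neq: "fst L1 \<noteq> fst L2"
    and f: "f \<in> heis_model omega psi L1"
  shows "averaging omega L3 (averaging omega L2 f) h = of_nat CARD('k) * f h"
proof -
  note lag = oriented_lagrangianD(1)[OF assms(1)] oriented_lagrangianD(1)[OF assms(2)]
  obtain e1 e2 where e1: "e1 \<in> fst L1" "e1 \<noteq> 0" and e2: "e2 \<in> fst L2" "e2 \<noteq> 0"
    using lagrangian_nonzero lag by blast
  have sub: "subspace (fst L1)" using lag(1) by (simp add: lagrangian_def)
  have w: "omega e1 e2 \<noteq> 0" by (rule distinct_lines_omega[OF lag neq e1 e2])
  have split: "heis_mult omega (scale s e2, 0) (scale t e1, 0)
    = heis_mult omega (0, - (s * omega e1 e2) * t)
        (heis_mult omega (scale t e1, 0) (scale s e2, 0))" for s t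
    unfolding heis_mult_def by (simp add: omega_swap[of e2 e1] two field_simps)
  have "f (heis_mult omega (scale s e2, 0) (heis_mult omega (scale t e1, 0) h))
    = psi (- (s * omega e1 e2) * t) * f (heis_mult omega (scale s e2, 0) h)" for s t
  proof -
    have "scale t e1 \<in> fst L1" using sub e1(1) by (rule subspace_scale)
    then show ?thesis
      unfolding heis_mult_assoc[symmetric] split
      by (simp add: heis_mult_assoc heis_model_central[OF f assms(1)] heis_model_line[OF f])
  qed
  then have "averaging omega L3 (averaging omega L2 f) h
    = (\<Sum>t\<in>UNIV. \<Sum>s\<in>UNIV. psi (- (s * omega e1 e2) * t) * f (heis_mult omega (scale s e2, 0) h))"
    unfolding averaging_def sum_line[OF lag(2) e2] eq[symmetric] sum_line[OF lag(1) e1] by simp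
  also have "\<dots> = (\<Sum>s\<in>UNIV. \<Sum>t\<in>UNIV. psi (- (s * omega e1 e2) * t)
      * f (heis_mult omega (scale s e2, 0) h))"
    by (rule sum.swap)
  also have "\<dots> = (\<Sum>s\<in>UNIV. (if s = 0 then of_nat CARD('k) else 0)
      * f (heis_mult omega (scale s e2, 0) h))"
    \<comment> \<open>The coefficient of \<open>t\<close> vanishes exactly for \<open>s = 0\<close>,
      as \<open>omega e1 e2\<close> is nonzero.\<close>
    using w by (simp only: sum_additive_character[OF psi] neg_equal_0_iff_equal mult_eq_0_iff
      simp_thms flip: sum_distrib_right)
  also have "\<dots> = (\<Sum>s\<in>(UNIV::'k set). if s = 0 then of_nat CARD('k) * f h else 0)"
    by (rule sum.cong) (auto simp: heis_mult_def)
  finally show ?thesis by simp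
qed

section \<open>Values of the intertwiners and their composition\<close>

lemma intertwiner_same_line:
  assumes "oriented_lagrangian scale omega L1" "oriented_lagrangian scale omega L2"
    and eq: "fst L1 = fst L2" and e: "e \<in> fst L1" "e \<noteq> 0"
    and f: "f \<in> heis_model omega psi L1"
  shows "intertwiner omega psi L2 L1 f h = of_int (snd L1 e * snd L2 e) * f h"
proof -
  have sq: "snd L2 e * snd L2 e = 1"
    using oriented_lagrangianD(4)[OF assms(2)] e eq by simp
  have "snd L1 = snd L2 \<or> snd L1 = (\<lambda>l. - snd L2 l)"
    using orientation_dichotomy[of "fst L1" "snd L1" "snd L2"] assms(1,2)
    by (metis eq prod.collapse)
  \<comment> \<open>Opposite orientations must fail the equality test in \<open>intertwiner\<close>;
    they do, since the value at \<open>e\<close> is nonzero.\<close>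
  moreover have "(\<lambda>l. - snd L2 l) \<noteq> snd L2"
    using sq by (metis equal_neg_zero mult_zero_left zero_neq_one)
  ultimately show ?thesis
    using f eq sq by (auto simp: intertwiner_def simp flip: of_int_mult)
qed

lemma intertwiner_distinct_lines:
  assumes "oriented_lagrangian scale omega L1" "oriented_lagrangian scale omega L2"
    and neq: "fst L1 \<noteq> fst L2"
    and e: "e1 \<in> fst L1" "e1 \<noteq> 0" "e2 \<in> fst L2" "e2 \<noteq> 0"
    and f: "f \<in> heis_model omega psi L1"
  shows "intertwiner omega psi L2 L1 f h
    = gauss_sum psi / of_nat CARD('k)
      * of_int (quadratic_character (omega e1 e2 / 2) * snd L1 e1 * snd L2 e2)
      * averaging omega L2 f h"
  using f neq by (simp add: intertwiner_def normalization_value[OF assms(1,2) e])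

lemma averaging_scale: "averaging omega L (\<lambda>h. c * f h) h = c * averaging omega L f h"
  by (simp add: averaging_def sum_distrib_left)

text \<open>The cases are the possible coincidences among the three lines. In each, the sign of the
  middle orientation at \<open>e2\<close> occurs twice and cancels.\<close>

lemma intertwiner_comp:
  assumes o: "oriented_lagrangian scale omega L1" "oriented_lagrangian scale omega L2"
      "oriented_lagrangian scale omega L3"
    and f: "f \<in> heis_model omega psi L1"
  shows "intertwiner omega psi L3 L2 (intertwiner omega psi L2 L1 f) h
    = intertwiner omega psi L3 L1 f h"
proof -
  let ?q = "of_nat CARD('k) :: complex" and ?G = "gauss_sum psi"
  let ?\<sigma> = "quadratic_character :: 'k \<Rightarrow> int"
  note lag = o[THEN oriented_lagrangianD(1)]
  have q: "?q \<noteq> 0" by simp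
  have G: "?G * ?G = of_int (?\<sigma> (- 1)) * ?q" by (rule gauss_sum_square[OF psi two])
  define g where "g = intertwiner omega psi L2 L1 f"
  \<comment> \<open>The outer operator is extensional, so its formulas apply only to members of this
    model.\<close>
  have g: "g \<in> heis_model omega psi L2"
    unfolding g_def using intertwiner_funcset[OF o(1,2)] f by (rule PiE_mem)
  obtain e2 where e2: "e2 \<in> fst L2" "e2 \<noteq> 0" using lagrangian_nonzero[OF lag(2)] by blast
  note sq2 = oriented_lagrangianD(4)[OF o(2) e2]
  have sq2': "of_int (snd L2 e2) * of_int (snd L2 e2) = (1::complex)"
    using sq2 by (simp flip: of_int_mult)
  have "intertwiner omega psi L3 L2 g h = intertwiner omega psi L3 L1 f h"
  proof (cases "fst L1 = fst L2")
    case True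
    \<comment> \<open>The model depends only on the underlying line, not on its orientation.\<close>
    have f2: "f \<in> heis_model omega psi L2" using f True by (simp add: heis_model_def)
    have e2': "e2 \<in> fst L1" using e2 True by simp
    have g_eq: "g = (\<lambda>h. of_int (snd L1 e2 * snd L2 e2) * f h)"
      unfolding g_def by (rule ext) (rule intertwiner_same_line[OF o(1,2) True e2' e2(2) f])
    show ?thesis
    proof (cases "fst L2 = fst L3")
      case True2: True
      have "fst L1 = fst L3" using True True2 by simp
      from intertwiner_same_line[OF o(1,3) this e2' e2(2) f, of h]
        intertwiner_same_line[OF o(2,3) True2 e2 g, of h] sq2'
      show ?thesis by (simp add: g_eq)
    next
      case False
      obtain e3 where e3: "e3 \<in> fst L3" "e3 \<noteq> 0" using lagrangian_nonzero[OF lag(3)] by blast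
      have "fst L1 \<noteq> fst L3" using True False by simp
      note F31 = intertwiner_distinct_lines[OF o(1,3) this e2' e2(2) e3 f]
      have "intertwiner omega psi L3 L2 g h
        = ?G / ?q * of_int (?\<sigma> (omega e2 e3 / 2) * snd L2 e2 * snd L3 e3)
          * (of_int (snd L1 e2 * snd L2 e2) * averaging omega L3 f h)"
        unfolding intertwiner_distinct_lines[OF o(2,3) False e2 e3 g]
        by (simp only: g_eq averaging_scale)
      also have "\<dots> = of_int (snd L2 e2 * snd L2 e2) * intertwiner omega psi L3 L1 f h"
        by (simp add: F31 mult_ac)
      finally show ?thesis by (simp add: sq2)
    qed
  next
    case False
    obtain e1 where e1: "e1 \<in> fst L1" "e1 \<noteq> 0" using lagrangian_nonzero[OF lag(1)] by blast
    have g_eq: "g = (\<lambda>h. ?G / ?q * of_int (?\<sigma> (omega e1 e2 / 2) * snd L1 e1 * snd L2 e2)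
        * averaging omega L2 f h)"
      unfolding g_def by (rule ext) (rule intertwiner_distinct_lines[OF o(1,2) False e1 e2 f])
    have w12: "omega e1 e2 \<noteq> 0" by (rule distinct_lines_omega[OF lag(1,2) False e1 e2])
    show ?thesis
    proof (cases "fst L2 = fst L3")
      case True
      have neq: "fst L1 \<noteq> fst L3" using True False by simp
      have e2': "e2 \<in> fst L3" using e2 True by simp
      have avg: "averaging omega L3 f h = averaging omega L2 f h"
        using True by (simp add: averaging_def)
      note F31 = intertwiner_distinct_lines[OF o(1,3) neq e1 e2' e2(2) f]
      have "intertwiner omega psi L3 L2 g h
        = of_int (snd L2 e2 * snd L2 e2) * intertwiner omega psi L3 L1 f h"
        unfolding intertwiner_same_line[OF o(2,3) True e2 g] F31 avg
        by (simp add: g_eq mult_ac)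
      then show ?thesis by (simp add: sq2)
    next
      case neq23: False
      show ?thesis
      proof (cases "fst L1 = fst L3")
        case True
        have e1': "e1 \<in> fst L3" using e1 True by simp
        \<comment> \<open>By antisymmetry the two arguments multiply to -1 times a square. The
          resulting \<sigma>(-1) cancels the one from the squared Gauss sum.\<close>
        have "?\<sigma> (omega e1 e2 / 2) * ?\<sigma> (omega e2 e1 / 2) = ?\<sigma> ((omega e1 e2 / 2)\<^sup>2 * - 1)"
          by (simp add: omega_swap[of e2 e1] power2_eq_square flip: quadratic_character_mult[OF two])
        also have "\<dots> = ?\<sigma> (- 1)"
          by (rule quadratic_character_square_mult) (use w12 two in simp)
        finally have s: "?\<sigma> (omega e1 e2 / 2) * ?\<sigma> (omega e2 e1 / 2) = ?\<sigma> (- 1)" .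
        have "intertwiner omega psi L3 L2 g h
          = ?G / ?q * of_int (?\<sigma> (omega e2 e1 / 2) * snd L2 e2 * snd L3 e1)
            * (?G / ?q * of_int (?\<sigma> (omega e1 e2 / 2) * snd L1 e1 * snd L2 e2) * (?q * f h))"
          unfolding intertwiner_distinct_lines[OF o(2,3) neq23 e2 e1' e1(2) g]
          by (simp only: g_eq averaging_scale averaging_averaging_back[OF o True False f])
        also have "\<dots> = (?G * ?G) / ?q
            * of_int (?\<sigma> (omega e1 e2 / 2) * ?\<sigma> (omega e2 e1 / 2))
            * of_int (snd L2 e2 * snd L2 e2) * of_int (snd L1 e1 * snd L3 e1) * f h"
          by (simp add: field_simps)
        also have "\<dots> = of_int (?\<sigma> (- 1) * ?\<sigma> (- 1)) * of_int (snd L1 e1 * snd L3 e1) * f h"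
          unfolding G s sq2 by simp
        also have "\<dots> = intertwiner omega psi L3 L1 f h"
          by (simp only: quadratic_character_self_mult[of "- 1 :: 'k"] neg_equal_0_iff_equal
            one_neq_zero not_False_eq_True of_int_1 mult_1
            intertwiner_same_line[OF o(1,3) True e1 f])
        finally show ?thesis .
      next
        case neq13: False
        obtain e3 where e3: "e3 \<in> fst L3" "e3 \<noteq> 0" using lagrangian_nonzero[OF lag(3)] by blast
        have w13: "omega e1 e3 \<noteq> 0" by (rule distinct_lines_omega[OF lag(1,3) neq13 e1 e3])
        have w23: "omega e2 e3 \<noteq> 0" by (rule distinct_lines_omega[OF lag(2,3) neq23 e2 e3])
        \<comment> \<open>This is the coefficient of the quadratic phase in
          \<open>averaging_averaging_distinct\<close>.\<close>
        define c where "c = - (omega e1 e2 * omega e2 e3 / omega e1 e3) / 2"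
        have c: "c \<noteq> 0" using w12 w13 w23 two by (simp add: c_def)
        have "?\<sigma> (omega e1 e2 / 2) * ?\<sigma> (omega e2 e3 / 2) * ?\<sigma> c
            = ?\<sigma> (omega e1 e2 / 2 * (omega e2 e3 / 2) * c)"
          by (simp only: quadratic_character_mult[OF two])
        \<comment> \<open>Modulo squares only \<open>- omega e1 e3 / 2\<close> survives, which
          supplies the \<sigma> factor of the direct operator from \<open>L1\<close> to
          \<open>L3\<close>.\<close>
        also have "omega e1 e2 / 2 * (omega e2 e3 / 2) * c
            = (omega e1 e2 * omega e2 e3 / (2 * omega e1 e3))\<^sup>2 * (- 1 * (omega e1 e3 / 2))"
          using w13 two by (simp add: c_def power2_eq_square field_simps)
        also have "?\<sigma> \<dots> = ?\<sigma> (- 1 * (omega e1 e3 / 2))"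
          by (rule quadratic_character_square_mult) (use w12 w13 w23 two in simp)
        also have "\<dots> = ?\<sigma> (- 1) * ?\<sigma> (omega e1 e3 / 2)"
          by (rule quadratic_character_mult[OF two])
        finally have s: "?\<sigma> (omega e1 e2 / 2) * ?\<sigma> (omega e2 e3 / 2) * ?\<sigma> c
          = ?\<sigma> (- 1) * ?\<sigma> (omega e1 e3 / 2)" .
        have "intertwiner omega psi L3 L2 g h
          = ?G / ?q * of_int (?\<sigma> (omega e2 e3 / 2) * snd L2 e2 * snd L3 e3)
            * (?G / ?q * of_int (?\<sigma> (omega e1 e2 / 2) * snd L1 e1 * snd L2 e2)
              * (of_int (?\<sigma> c) * ?G * averaging omega L3 f h))"
          unfolding intertwiner_distinct_lines[OF o(2,3) neq23 e2 e3 g]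
          by (simp only: g_eq averaging_scale
            averaging_averaging_distinct[OF o e1 e2 e3 f w13, folded c_def]
            quadratic_gauss_sum[OF psi two c])
        \<comment> \<open>Two Gauss sums come from the normalizations and one from the quadratic
          phase. Evaluating one square leaves \<open>?G / ?q\<close>, as the direct operator
          requires, and a second \<sigma>(-1).\<close>
        also have "\<dots> = ?G * (?G * ?G) / (?q * ?q)
            * of_int (?\<sigma> (omega e1 e2 / 2) * ?\<sigma> (omega e2 e3 / 2) * ?\<sigma> c)
            * of_int (snd L2 e2 * snd L2 e2) * of_int (snd L1 e1 * snd L3 e3)
            * averaging omega L3 f h"
          by (simp add: field_simps)
        also have "\<dots> = ?G / ?q * of_int (?\<sigma> (- 1) * ?\<sigma> (- 1))
            * of_int (?\<sigma> (omega e1 e3 / 2) * snd L1 e1 * snd L3 e3) * averaging omega L3 f h"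
          unfolding G s sq2 by (simp add: field_simps)
        also have "\<dots> = intertwiner omega psi L3 L1 f h"
          by (simp only: quadratic_character_self_mult[of "- 1 :: 'k"] neg_equal_0_iff_equal
            one_neq_zero not_False_eq_True of_int_1 mult_1_right
            intertwiner_distinct_lines[OF o(1,3) neq13 e1 e3 f])
        finally show ?thesis .
      qed
    qed
  qed
  then show ?thesis by (simp add: g_def)
qed

end

theorem theoremA3:
  fixes scale :: "'k::{field,finite} \<Rightarrow> 'v::ab_group_add \<Rightarrow> 'v"
    and omega :: "'v \<Rightarrow> 'v \<Rightarrow> 'k"
    and psi :: "'k \<Rightarrow> complex"
    and L1 L2 L3 :: "'v oriented"
  assumes "odd CHAR('k)"
    and "symplectic_plane scale omega"
    and "nontrivial_additive_character psi"
    and "oriented_lagrangian scale omega L1"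
    and "oriented_lagrangian scale omega L2"
    and "oriented_lagrangian scale omega L3"
  shows "compose (heis_model omega psi L1)
           (intertwiner omega psi L3 L2) (intertwiner omega psi L2 L1)
         = intertwiner omega psi L3 L1"
proof -
  have "of_nat 2 \<noteq> (0::'k)"
    unfolding of_nat_eq_0_iff_char_dvd
  proof
    assume "CHAR('k) dvd 2"
    then have "CHAR('k) \<le> 2" by (rule dvd_imp_le) simp
    \<comment> \<open>Oddness excludes both 0 and 2.\<close>
    then have "CHAR('k) = 1" using assms(1) by (auto simp: numeral_2_eq_2 le_Suc_eq)
    then show False using CHAR_not_1 by simp
  qed
  then interpret heisenberg_plane scale omega psi
    using assms(2,3) by (simp add: heisenberg_plane_def heisenberg_plane_axioms_def)
  show ?thesis
  proof
    fix f
    show "compose (heis_model omega psi L1)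
        (intertwiner omega psi L3 L2) (intertwiner omega psi L2 L1) f = intertwiner omega psi L3 L1 f"
    proof (cases "f \<in> heis_model omega psi L1")
      case True
      then show ?thesis
        by (simp only: compose_eq) (rule ext, rule intertwiner_comp[OF assms(4-6) True])
    next
      case False
      \<comment> \<open>Outside the model both sides take the value
        \<open>undefined\<close>.\<close>
      then show ?thesis by (simp add: compose_def intertwiner_def)
    qed
  qed
qed

end
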